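(* Let $n\ge 0$, let $X\subseteq\{0,1\}^n$, and let $G=Q_n(X)$ be the daisy cube generated by $X$. Then for every vertex $u$ of $G$, $$D_{G,u}(x,-x)=1$$ as polynomials in $x$, where $D_{G,u}(x,y)$ is the distance cube polynomial of $G$ with respect to $u$.
   Context: The $n$-cube $Q_n$ is the graph with vertex set $\{0,1\}^n$, two words being adjacent if they differ in exactly one coordinate ($Q_0=K_1$). For $u,v\in\{0,1\}^n$ write $u\le v$ if $u_i\le v_i$ for all $i$. For $X\subseteq\{0,1\}^n$, the daisy cube $Q_n(X)$ generated by $X$ is the subgraph of $Q_n$ induced by $\{u\in\{0,1\}^n : u\le x \text{ for some } x\in X\}$. For a finite graph $G$, $u\in V(G)$ and a subgraph $H$ of $G$, $d(u,H)=\min_{v\in V(H)}d_G(u,v)$. Let $c_{k,d}(G)$ ($k,d\ge 0$) be the number of induced subgraphs $H$ of $G$ isomorphic to $Q_k$ with $d(u,H)=d$. The distance cube polynomial of $G$ with respect to $u$ is $D_{G,u}(x,y)=\sum_{k,d\ge0}c_{k,d}(G)x^ky^d$. *)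

theory Defs
  imports "Graph_Theory.Graph_Theory" "HOL-Computational_Algebra.Polynomial"
begin

text \<open>
  An undirected simple graph is a digraph with a symmetric, loop-free arc set without parallel
  arcs: every edge is represented by its two orientations. Words over \<open>{0,1}\<close> are Boolean lists,
  with \<open>False\<close> for \<open>0\<close> and \<open>True\<close> for \<open>1\<close>.
\<close>

definition hypercube :: "nat \<Rightarrow> (bool list, bool list \<times> bool list) pre_digraph" where
  "hypercube n = with_proj
     \<lparr> pverts = {u. length u = n},
       parcs = {(u, v). length u = n \<and> length v = n \<and> card {i. i < n \<and> u ! i \<noteq> v ! i} = 1} \<rparr>"

definition daisy_cube ::
    "nat \<Rightarrow> bool list set \<Rightarrow> (bool list, bool list \<times> bool list) pre_digraph" where
  "daisy_cube n X =
     hypercube n \<restriction> {u \<in> verts (hypercube n). \<exists>x\<in>X. list_all2 (\<le>) u x}"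

text \<open>
  The distance is the least cost of a walk when every arc has cost \<open>1\<close>; it is \<open>\<infinity>\<close> between
  different components.
\<close>

definition graph_dist :: "('a, 'b) pre_digraph \<Rightarrow> 'a \<Rightarrow> 'a \<Rightarrow> ereal" where
  "graph_dist G u v = wf_digraph.\<mu> G (\<lambda>_. 1) u v"

definition subgraph_dist ::
    "('a, 'b) pre_digraph \<Rightarrow> 'a \<Rightarrow> ('a, 'b) pre_digraph \<Rightarrow> ereal" where
  "subgraph_dist G u H = (MIN v\<in>verts H. graph_dist G u v)"

definition cube_count :: "('a, 'b) pre_digraph \<Rightarrow> 'a \<Rightarrow> nat \<Rightarrow> nat \<Rightarrow> nat" where
  "cube_count G u k d = card {H. induced_subgraph H G \<and> digraph_iso H (hypercube k) \<and>
     subgraph_dist G u H = ereal (real d)}"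

text \<open>
  A polynomial in \<open>x\<close> and \<open>y\<close> is a polynomial in \<open>y\<close> over the ring of integer polynomials in \<open>x\<close>.
  The sum ranges over the nonzero coefficients, of which a finite graph has only finitely many.
\<close>

definition distance_cube_poly :: "('a, 'b) pre_digraph \<Rightarrow> 'a \<Rightarrow> int poly poly" where
  "distance_cube_poly G u =
     (\<Sum>(k, d)\<in>{(k, d). cube_count G u k d \<noteq> 0}. monom (monom (int (cube_count G u k d)) k) d)"

lemma finite_induced_subgraphs:
  assumes "finite (verts G)"
  shows "finite {H. induced_subgraph H G}"
proof (rule finite_subset)
  show "{H. induced_subgraph H G} \<subseteq> (\<lambda>S. G \<restriction> S) ` Pow (verts G)"
  proof
    fix H assume "H \<in> {H. induced_subgraph H G}"
    then have "H = G \<restriction> verts H" "verts H \<in> Pow (verts G)"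
      by (auto simp: induced_subgraph_def subgraph_def compatible_def induce_subgraph_def)
    then show "H \<in> (\<lambda>S. G \<restriction> S) ` Pow (verts G)" by blast
  qed
qed (use assms in simp)

lemma card_verts_digraph_iso_hypercube:
  assumes "digraph_iso H (hypercube k)"
  shows "card (verts H) = 2 ^ k"
proof -
  obtain f where f: "pre_digraph.digraph_isomorphism H f" "hypercube k = app_iso f H"
    using assms unfolding digraph_iso_def by blast
  have "card (verts H) = card (verts (hypercube k))"
    using f pre_digraph.digraph_isomorphism_inj_on_verts[OF f(1)] by (simp add: card_image)
  also have "verts (hypercube k) = {w. set w \<subseteq> UNIV \<and> length w = k}"
    by (simp add: hypercube_def)
  also have "card \<dots> = 2 ^ k"
    using card_lists_length_eq[of "UNIV :: bool set" k] by simp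
  finally show ?thesis .
qed

lemma finite_cube_count_support:
  assumes "finite (verts G)"
  shows "finite {(k, d). cube_count G u k d \<noteq> 0}"
proof (rule finite_subset)
  let ?g = "\<lambda>H. (THE k. card (verts H) = 2 ^ k, THE d. subgraph_dist G u H = ereal (real d))"
  show "{(k, d). cube_count G u k d \<noteq> 0} \<subseteq> ?g ` {H. induced_subgraph H G}"
  proof safe
    fix k d assume "0 < cube_count G u k d"
    then obtain H where H: "induced_subgraph H G" "digraph_iso H (hypercube k)"
        "subgraph_dist G u H = ereal (real d)"
      unfolding cube_count_def by (fastforce simp: card_gt_0_iff)
    have "?g H = (k, d)"
      using H(3) card_verts_digraph_iso_hypercube[OF H(2)] by simp
    then show "(k, d) \<in> ?g ` {H. induced_subgraph H G}"
      using H(1) by (metis (no_types, lifting) imageI mem_Collect_eq)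
  qed
qed (use finite_induced_subgraphs[OF assms] in simp)

lemma coeff_distance_cube_poly:
  assumes "finite (verts G)"
  shows "coeff (coeff (distance_cube_poly G u) d) k = int (cube_count G u k d)"
proof -
  have "coeff (coeff (distance_cube_poly G u) d) k =
      (\<Sum>p\<in>{(k, d). cube_count G u k d \<noteq> 0}.
         if p = (k, d) then int (cube_count G u k d) else 0)"
    unfolding distance_cube_poly_def coeff_sum
    by (intro sum.cong) (auto simp: coeff_sum split: prod.splits)
  then show ?thesis
    using finite_cube_count_support[OF assms, of u] by (simp add: sum.delta)
qed

end

theory Submission
  imports Defs
begin

text \<open>
  Read words as subsets of \<open>{..<n}\<close>: the daisy cube becomes a down-closed family \<open>D\<close>, in which
  graph distance is Hamming distance. By the 4-cycle argument an embedded \<open>k\<close>-cube is a set of translates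
  of a fixed set by the subsets of a \<open>k\<close>-set, so the cubes in \<open>D\<close> are the intervals from
  \<open>B - S\<close> to \<open>B\<close> with \<open>S \<subseteq> B \<in> D\<close>, and such a cube lies at distance
  \<open>card (sym_diff U B - S)\<close> from \<open>U\<close>. For a fixed top \<open>B\<close>, the signed sum over \<open>S\<close> is a product
  over the elements of \<open>B\<close>, with a factor \<open>x - x = 0\<close> for every element outside \<open>U\<close>.
  The tops \<open>B \<subseteq> U\<close> remain, all of which lie in \<open>D\<close>, and they contribute
  \<open>((1 + x) - x) ^ card U = 1\<close>.
\<close>

section \<open>Signed sums over intervals\<close>

lemma sym_diff_eq_iff: "sym_diff A B = C \<longleftrightarrow> B = sym_diff A C"
  unfolding set_eq_iff by (rule arg_cong[where f = All]) auto

lemma card_sym_diff_triangle: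
  assumes "finite A" "finite B" "finite C"
  shows "card (sym_diff A C) \<le> card (sym_diff A B) + card (sym_diff B C)"
proof -
  have "card (sym_diff A C) \<le> card (sym_diff A B \<union> sym_diff B C)"
    using assms by (intro card_mono) auto
  then show ?thesis using card_Un_le order_trans by blast
qed

text \<open>Each element of \<open>B\<close> decides independently whether to join \<open>S\<close>,
  and every element of \<open>U - B\<close> contributes a constant factor \<open>-x\<close>.
  Expanding a product over \<open>B\<close> in reverse therefore gives the sum.\<close>

lemma signed_interval_sum:
  fixes x :: "'a::comm_ring_1"
  assumes "finite U" "finite B"
  shows "(\<Sum>S\<in>Pow B. x ^ card S * (-x) ^ card (sym_diff U B - S)) =
    (if B \<subseteq> U then (1 + x) ^ card B * (-x) ^ card (U - B) else 0)"
proof -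
  \<comment> \<open>The weight of an element of \<open>B\<close> left out of \<open>S\<close>: it
    adds to the exponent of \<open>-x\<close> exactly when it lies outside \<open>U\<close>.\<close>
  define c where "c i = (if i \<in> U then 1 else -x)" for i
  have summand: "x ^ card S * (-x) ^ card (sym_diff U B - S) =
      (-x) ^ card (U - B) * ((\<Prod>i\<in>S. x) * (\<Prod>i\<in>B - S. c i))" if "S \<in> Pow B" for S
  proof -
    have "sym_diff U B - S = (U - B) \<union> (B - S - U)" using that by auto
    then have "card (sym_diff U B - S) = card (U - B) + card (B - S - U)"
      using assms by (simp add: card_Un_disjoint Int_Diff Diff_Int_distrib2 disjoint_iff)
    moreover have "(\<Prod>i\<in>B - S. c i) = (-x) ^ card (B - S - U)"
    proof -
      have "(\<Prod>i\<in>B - S. c i) = (\<Prod>i\<in>B - S - U. c i)"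
        using assms by (intro prod.mono_neutral_right) (auto simp: c_def)
      also have "\<dots> = (-x) ^ card (B - S - U)"
        by (simp add: c_def)
      finally show ?thesis .
    qed
    ultimately show ?thesis by (simp add: power_add algebra_simps)
  qed
  have "(\<Sum>S\<in>Pow B. x ^ card S * (-x) ^ card (sym_diff U B - S)) =
      (-x) ^ card (U - B) * (\<Prod>i\<in>B. x + c i)"
    using summand by (simp add: prod_add[OF assms(2)] sum_distrib_left)
  moreover have "(\<Prod>i\<in>B. x + c i) = (1 + x) ^ card B" if "B \<subseteq> U"
    using that by (auto simp: c_def subset_iff add.commute)
  moreover have "(\<Prod>i\<in>B. x + c i) = 0" if b: "\<not> B \<subseteq> U"
  proof -
    obtain b where "b \<in> B" "b \<notin> U" using b by blast
    then have "b \<in> B" "x + c b = 0" by (auto simp: c_def)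
    then show ?thesis using assms(2) by (meson prod_zero)
  qed
  ultimately show ?thesis by (auto simp: mult.commute)
qed

text \<open>Only tops \<open>B \<subseteq> U\<close> survive the inner sum, and down-closure puts
  all of \<open>Pow U\<close> into \<open>D\<close>. What remains is the expansion of
  \<open>(1 + x) + (-x)\<close> multiplied over the elements of \<open>U\<close>.\<close>

lemma down_set_signed_sum:
  fixes x :: "'a::comm_ring_1"
  assumes "finite D" "\<And>A. A \<in> D \<Longrightarrow> finite A"
    and down: "\<And>A B. A \<in> D \<Longrightarrow> B \<subseteq> A \<Longrightarrow> B \<in> D" and "U \<in> D"
  shows "(\<Sum>(B, S)\<in>(SIGMA B:D. Pow B). x ^ card S * (-x) ^ card (sym_diff U B - S)) = 1"
proof -
  have fU: "finite U" using assms by blast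
  have "(\<Sum>(B, S)\<in>(SIGMA B:D. Pow B). x ^ card S * (-x) ^ card (sym_diff U B - S)) =
      (\<Sum>B\<in>D. \<Sum>S\<in>Pow B. x ^ card S * (-x) ^ card (sym_diff U B - S))"
    using assms(1,2) by (subst sum.Sigma) auto
  also have "\<dots> = (\<Sum>B\<in>D. if B \<subseteq> U then (1 + x) ^ card B * (-x) ^ card (U - B) else 0)"
    using assms(2) fU by (intro sum.cong signed_interval_sum) auto
  also have "\<dots> = (\<Sum>B\<in>Pow U. if B \<subseteq> U then (1 + x) ^ card B * (-x) ^ card (U - B) else 0)"
    using assms by (intro sum.mono_neutral_right) auto
  also have "\<dots> = (\<Sum>B\<in>Pow U. (\<Prod>i\<in>B. 1 + x) * (\<Prod>i\<in>U - B. - x))"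
    by (intro sum.cong) auto
  also have "\<dots> = 1"
    by (subst prod_add[OF fU, symmetric]) simp
  finally show ?thesis .
qed

section \<open>Subcubes of the hypercube\<close>

text \<open>Two sets differing in exactly two elements have just two common neighbours. In a 4-cycle
  of the cube, the images of three corners and injectivity thus fix the fourth, so the element
  toggled along an edge depends only on the coordinate \<open>i\<close> being flipped.\<close>

lemma cube_embedding_translation:
  fixes \<phi> :: "'a set \<Rightarrow> 'b set"
  assumes "finite I" and inj: "inj_on \<phi> (Pow I)"
    and adj: "\<And>A B. A \<subseteq> I \<Longrightarrow> B \<subseteq> I \<Longrightarrow> card (sym_diff A B) = 1 \<Longrightarrow>
      card (sym_diff (\<phi> A) (\<phi> B)) = 1"
  obtains e where "inj_on e I" "\<And>A. A \<subseteq> I \<Longrightarrow> \<phi> A = sym_diff (\<phi> {}) (e ` A)"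
proof -
  have adj': "\<exists>a. sym_diff (\<phi> A) (\<phi> (insert i A)) = {a}" if "i \<in> I" "i \<notin> A" "A \<subseteq> I" for A i
  proof -
    have "sym_diff A (insert i A) = {i}" using that by auto
    then show ?thesis using adj[of A "insert i A"] that by (auto simp: card_1_singleton_iff)
  qed
  \<comment> \<open>The direction of coordinate \<open>i\<close>, read off at the empty set.\<close>
  define e where "e i = the_elem (sym_diff (\<phi> {}) (\<phi> {i}))" for i
  have e: "sym_diff (\<phi> {}) (\<phi> {i}) = {e i}" if i: "i \<in> I" for i
  proof -
    obtain a where "sym_diff (\<phi> {}) (\<phi> {i}) = {a}" using adj'[of i "{}"] i by auto
    then show ?thesis unfolding e_def by (simp only: the_elem_eq)
  qed
  have e_single: "\<phi> {i} = sym_diff (\<phi> {}) {e i}" if "i \<in> I" for i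
    using e[OF that] by (simp add: sym_diff_eq_iff)
  have inj_e: "inj_on e I"
  proof (rule inj_onI)
    fix i j assume ij: "i \<in> I" "j \<in> I" "e i = e j"
    then have "\<phi> {i} = \<phi> {j}" using e_single by metis
    then show "i = j" using inj_onD[OF inj, of "{i}" "{j}"] ij by simp
  qed
  have "\<phi> A = sym_diff (\<phi> {}) (e ` A)" if "A \<subseteq> I" for A
    using finite_subset[OF that \<open>finite I\<close>] that
  proof (induction A rule: finite_psubset_induct)
    case (psubset A)
    \<comment> \<open>With two elements \<open>i\<close>, \<open>j\<close> available,
      \<open>A\<close> is the last corner of the 4-cycle through \<open>C\<close>,
      \<open>insert i C\<close> and \<open>insert j C\<close>, all proper subsets of
      \<open>A\<close>. This is why the induction runs over proper subsets.\<close>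
    consider "A = {}" | i where "A = {i}"
      | i j C where "A = insert i (insert j C)" "i \<noteq> j" "i \<notin> C" "j \<notin> C"
    proof (cases "A = {}")
      case False
      then obtain i A' where i: "A = insert i A'" "i \<notin> A'" by (meson Set.set_insert ex_in_conv)
      show thesis
      proof (cases "A' = {}")
        case False
        then obtain j C where "A' = insert j C" "j \<notin> C" by (meson Set.set_insert ex_in_conv)
        then show thesis using that(3)[of i j C] i by auto
      qed (use that(2) i in auto)
    qed (use that(1) in auto)
    then show ?case
    proof cases
      case 1
      then show ?thesis by simp
    next
      case 2
      then show ?thesis using e_single psubset.prems by auto
    next
      case 3
      have sub: "i \<in> I" "j \<in> I" "C \<subseteq> I" using 3 psubset.prems by auto
      have IH: "\<phi> C = sym_diff (\<phi> {}) (e ` C)"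
          "\<phi> (insert i C) = sym_diff (\<phi> {}) (e ` insert i C)"
          "\<phi> (insert j C) = sym_diff (\<phi> {}) (e ` insert j C)"
        using 3 sub by (intro psubset.IH; auto)+
      obtain a where a: "sym_diff (\<phi> (insert i C)) (\<phi> A) = {a}"
        using adj'[of j "insert i C"] 3 sub by (auto simp: insert_commute)
      obtain b where b: "sym_diff (\<phi> (insert j C)) (\<phi> A) = {b}"
        using adj'[of i "insert j C"] 3 sub by auto
      have ne: "e i \<noteq> e j" "e i \<notin> e ` C" "e j \<notin> e ` C"
        using inj_e 3 sub by (auto dest: inj_onD)
      have A_i: "x \<in> \<phi> A \<longleftrightarrow> ((x \<in> \<phi> {}) \<noteq> (x \<in> e ` C \<or> x = e i)) \<noteq> (x = a)" for x
        using a unfolding sym_diff_eq_iff IH(2) by auto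
      have A_j: "x \<in> \<phi> A \<longleftrightarrow> ((x \<in> \<phi> {}) \<noteq> (x \<in> e ` C \<or> x = e j)) \<noteq> (x = b)" for x
        using b unfolding sym_diff_eq_iff IH(3) by auto
      have A_C: "x \<in> \<phi> C \<longleftrightarrow> (x \<in> \<phi> {}) \<noteq> (x \<in> e ` C)" for x
        using IH(1) by auto
      \<comment> \<open>Toggling \<open>e i\<close> a second time would lead back to
        \<open>\<phi> C\<close>, against injectivity.\<close>
      have "a \<noteq> e i"
      proof
        assume "a = e i"
        then have "x \<in> \<phi> A \<longleftrightarrow> x \<in> \<phi> C" for x using A_i[of x] A_C[of x] ne(2) by metis
        then have "\<phi> A = \<phi> C" by blast
        then show False using inj_onD[OF inj, of A C] 3 sub psubset.prems by auto
      qed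
      \<comment> \<open>At \<open>e i\<close> the two descriptions of \<open>\<phi> A\<close> force
        \<open>b = e i\<close>; at \<open>e j\<close> they then force
        \<open>a = e j\<close>.\<close>
      have "a = e j" using A_i[of "e i"] A_j[of "e i"] A_i[of "e j"] A_j[of "e j"] ne \<open>a \<noteq> e i\<close>
        by metis
      then have "x \<in> \<phi> A \<longleftrightarrow> (x \<in> \<phi> {}) \<noteq> (x \<in> e ` C \<or> x = e i \<or> x = e j)" for x
        using A_i[of x] ne by metis
      then have "x \<in> \<phi> A \<longleftrightarrow> x \<in> sym_diff (\<phi> {}) (e ` A)" for x
        unfolding 3(1) image_insert by auto
      then show ?thesis by blast
    qed
  qed
  with inj_e show thesis by (rule that)
qed

section \<open>Words as subsets of an initial segment\<close>

definition ones :: "bool list \<Rightarrow> nat set" where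
  "ones w = {i. i < length w \<and> w ! i}"

text \<open>Inverse to \<open>ones\<close> on words of length \<open>n\<close>. Elements of
  \<open>A\<close> from \<open>n\<close> onwards are cut off, hence the intersection in
  \<open>ones_word\<close>.\<close>

definition word :: "nat \<Rightarrow> nat set \<Rightarrow> bool list" where
  "word n A = map (\<lambda>i. i \<in> A) [0..<n]"

lemma length_word [simp]: "length (word n A) = n"
  by (simp add: word_def)

lemma ones_word [simp]: "ones (word n A) = A \<inter> {..<n}"
  by (auto simp: ones_def word_def)

lemma word_ones [simp]: "length w = n \<Longrightarrow> word n (ones w) = w"
  by (auto simp: ones_def word_def intro: nth_equalityI)

lemma ones_subset: "length w = n \<Longrightarrow> ones w \<subseteq> {..<n}"
  by (auto simp: ones_def)

lemma finite_ones [simp]: "finite (ones w)"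
  by (simp add: ones_def)

lemma ones_inject: "ones u = ones v \<Longrightarrow> length u = length v \<Longrightarrow> u = v"
  by (metis word_ones)

lemma differing_positions:
  assumes "length u = n" "length v = n"
  shows "{i. i < n \<and> u ! i \<noteq> v ! i} = sym_diff (ones u) (ones v)"
  using assms by (auto simp: ones_def)

lemma list_all2_le_iff_ones:
  "list_all2 (\<le>) u x \<longleftrightarrow> length u = length x \<and> ones u \<subseteq> ones x"
  by (auto simp: list_all2_conv_all_nth ones_def)

section \<open>The hypercube and its faces\<close>

lemma verts_hypercube [simp]: "verts (hypercube n) = {w. length w = n}"
  and tail_hypercube [simp]: "tail (hypercube n) = fst"
  and head_hypercube [simp]: "head (hypercube n) = snd"
  by (simp_all add: hypercube_def)

lemma arcs_hypercube [simp]: "arcs (hypercube n) =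
    {(u, v). length u = n \<and> length v = n \<and> card (sym_diff (ones u) (ones v)) = 1}"
  unfolding hypercube_def with_proj_simps pair_pre_digraph.select_convs
  by (rule arg_cong[of _ _ Collect]) (auto simp only: fun_eq_iff differing_positions)

lemma wf_digraph_hypercube: "wf_digraph (hypercube n)"
  by unfold_locales auto

text \<open>An interval recorded by its top \<open>B\<close> and its set \<open>S\<close> of free
  coordinates, matching the order of summation: first over tops, then over \<open>S\<close>.\<close>

definition cube_face :: "nat \<Rightarrow> nat set \<Rightarrow> nat set \<Rightarrow> bool list set" where
  "cube_face n B S = {w. length w = n \<and> B - S \<subseteq> ones w \<and> ones w \<subseteq> B}"

text \<open>The top and the bottom are the largest and smallest members of a face, and
  \<open>S\<close> is their difference.\<close>

lemma cube_face_inject: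
  assumes "B \<subseteq> {..<n}" "B' \<subseteq> {..<n}" "S \<subseteq> B" "S' \<subseteq> B'"
    and eq: "cube_face n B S = cube_face n B' S'"
  shows "B = B'" "S = S'"
proof -
  have "word n B \<in> cube_face n B' S'" "word n (B - S) \<in> cube_face n B' S'"
    unfolding eq[symmetric] using assms(1,3) by (auto simp: cube_face_def)
  moreover have "word n B' \<in> cube_face n B S" "word n (B' - S') \<in> cube_face n B S"
    unfolding eq using assms(2,4) by (auto simp: cube_face_def)
  ultimately have "B \<subseteq> B'" "B' \<subseteq> B" "B - S = B' - S'"
    using assms(1,2) by (auto simp: cube_face_def)
  then show "B = B'" "S = S'" using assms(3,4) by auto
qed

text \<open>A digraph isomorphism carries separate maps on vertices and arcs. Arcs here are pairs of
  endpoints, so the vertex map determines the arc map, and only a bijection preserving and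
  reflecting adjacency is left.\<close>

lemma digraph_iso_induced_hypercube_iff:
  assumes "V \<subseteq> {w. length w = n}"
  shows "digraph_iso (hypercube n \<restriction> V) (hypercube k) \<longleftrightarrow>
    (\<exists>f. bij_betw f V {w. length w = k} \<and>
      (\<forall>x\<in>V. \<forall>y\<in>V. card (sym_diff (ones x) (ones y)) = 1 \<longleftrightarrow>
        card (sym_diff (ones (f x)) (ones (f y))) = 1))"
    (is "?L \<longleftrightarrow> (\<exists>f. ?bij f \<and> ?adj f)")
proof
  assume ?L
  then obtain h where h: "pre_digraph.digraph_isomorphism (hypercube n \<restriction> V) h"
    and Q: "hypercube k = app_iso h (hypercube n \<restriction> V)"
    unfolding digraph_iso_def by blast
  let ?f = "iso_verts h"
  \<comment> \<open>An isomorphism record also supplies the \<open>tail\<close> and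
    \<open>head\<close> of its target; as the target is a hypercube, these are the
    projections.\<close>
  have ht: "iso_tail h = fst" "iso_head h = snd"
    using arg_cong[OF Q, of tail] arg_cong[OF Q, of head] by simp_all
  have inj: "inj_on ?f V"
    using h by (simp add: pre_digraph.digraph_isomorphism_def)
  have V: "?f ` V = {w. length w = k}"
    using arg_cong[OF Q, of verts] by simp
  have arc: "iso_arcs h (x, y) = (?f x, ?f y)" if "(x, y) \<in> arcs (hypercube n \<restriction> V)" for x y
    using h that unfolding pre_digraph.digraph_isomorphism_def
    by (metis ht fst_conv snd_conv induce_subgraph_head induce_subgraph_tail
        head_hypercube tail_hypercube prod.collapse)
  have arcs_img: "arcs (hypercube k) = iso_arcs h ` arcs (hypercube n \<restriction> V)"
    using arg_cong[OF Q, of arcs] by (simp del: arcs_hypercube)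
  have "?adj ?f"
  proof (intro ballI iffI)
    fix x y assume xy: "x \<in> V" "y \<in> V"
    {
      assume "card (sym_diff (ones x) (ones y)) = 1"
      then have "(x, y) \<in> arcs (hypercube n \<restriction> V)" using xy assms by auto
      then have "(?f x, ?f y) \<in> arcs (hypercube k)"
        unfolding arcs_img using arc by (metis imageI)
      then show "card (sym_diff (ones (?f x)) (ones (?f y))) = 1" by simp
    next
      assume "card (sym_diff (ones (?f x)) (ones (?f y))) = 1"
      then have "(?f x, ?f y) \<in> arcs (hypercube k)" using V xy by auto
      then obtain a b where ab: "(a, b) \<in> arcs (hypercube n \<restriction> V)"
          "(?f x, ?f y) = iso_arcs h (a, b)"
        unfolding arcs_img by fast
      then have "a \<in> V" "b \<in> V" by auto
      moreover have "?f x = ?f a" "?f y = ?f b" using ab arc by auto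
      ultimately have "x = a" "y = b" using inj xy by (auto dest: inj_onD)
      then show "card (sym_diff (ones x) (ones y)) = 1" using ab(1) by simp
    }
  qed
  then show "\<exists>f. ?bij f \<and> ?adj f" using inj V by (auto simp: bij_betw_def)
next
  assume "\<exists>f. ?bij f \<and> ?adj f"
  then obtain f where f: "inj_on f V" "f ` V = {w. length w = k}" and adj: "?adj f"
    by (auto simp: bij_betw_def)
  define h where "h = \<lparr>iso_verts = f, iso_arcs = map_prod f f, iso_head = snd, iso_tail = fst\<rparr>"
  have "inj_on (map_prod f f) (arcs (hypercube n \<restriction> V))"
    using f(1) by (auto intro!: inj_onI dest: inj_onD)
  then have "pre_digraph.digraph_isomorphism (hypercube n \<restriction> V) h"
    using f(1) wf_digraph.wellformed_induce_subgraph[OF wf_digraph_hypercube]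
    by (simp add: pre_digraph.digraph_isomorphism_def h_def del: arcs_hypercube)
  moreover have "hypercube k = app_iso h (hypercube n \<restriction> V)"
  proof (rule pre_digraph.equality)
    show "arcs (hypercube k) = arcs (app_iso h (hypercube n \<restriction> V))"
    proof (intro equalityI subsetI)
      fix a assume "a \<in> arcs (hypercube k)"
      then obtain p q where a: "a = (p, q)" "length p = k" "length q = k"
        "card (sym_diff (ones p) (ones q)) = 1" by auto
      obtain x where "x \<in> V" "p = f x" using f(2) a(2) by blast
      moreover obtain y where "y \<in> V" "q = f y" using f(2) a(3) by blast
      ultimately have "a = map_prod f f (x, y)" "(x, y) \<in> arcs (hypercube n \<restriction> V)"
        using a adj assms by auto
      then show "a \<in> arcs (app_iso h (hypercube n \<restriction> V))" unfolding h_def by auto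
    next
      fix a assume "a \<in> arcs (app_iso h (hypercube n \<restriction> V))"
      then obtain x y where "a = (f x, f y)" "x \<in> V" "y \<in> V"
          "card (sym_diff (ones x) (ones y)) = 1"
        by (auto simp: h_def)
      then show "a \<in> arcs (hypercube k)" using f(2) adj by auto
    qed
  qed (use f(2) in \<open>auto simp: h_def\<close>)
  ultimately show ?L unfolding digraph_iso_def by blast
qed

text \<open>Words of a face agree outside \<open>S\<close>, so keeping only the coordinates in
  \<open>S\<close>, renumbered along \<open>e\<close>, loses no difference between them.\<close>

lemma digraph_iso_cube_face:
  assumes "B \<subseteq> {..<n}" "S \<subseteq> B"
  shows "digraph_iso (hypercube n \<restriction> cube_face n B S) (hypercube (card S))"
proof -
  have fS: "finite S" using assms by (meson finite_lessThan finite_subset)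
  obtain e where e: "bij_betw e {..<card S} S"
    using ex_bij_betw_nat_finite[OF fS] by (auto simp: atLeast0LessThan)
  have eS: "e ` {..<card S} = S" "inj_on e {..<card S}" using e by (auto simp: bij_betw_def)
  \<comment> \<open>\<open>f\<close> reads the free coordinates and \<open>g\<close> restores the
    fixed part \<open>B - S\<close>. The preimage under \<open>e\<close> may contain indices from
    \<open>card S\<close> onwards; \<open>word\<close> drops them.\<close>
  define f where "f w = word (card S) (e -` ones w)" for w
  define g where "g z = word n (B - S \<union> e ` ones z)" for z
  have onesf: "ones (f w) = {..<card S} \<inter> e -` ones w" for w
    by (auto simp: f_def)
  have onesg: "ones (g z) = B - S \<union> e ` ones z" if "length z = card S" for z
  proof -
    have "e ` ones z \<subseteq> S" using ones_subset[OF that] eS by blast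
    then show ?thesis using assms by (auto simp: g_def)
  qed
  have bij: "bij_betw f (cube_face n B S) {w. length w = card S}"
  proof (rule bij_betw_byWitness[where f' = g])
    show "\<forall>w\<in>cube_face n B S. g (f w) = w"
    proof
      fix w assume w: "w \<in> cube_face n B S"
      have "e ` ({..<card S} \<inter> e -` ones w) = e ` {..<card S} \<inter> ones w" by auto
      then have "e ` ({..<card S} \<inter> e -` ones w) = S \<inter> ones w" unfolding eS(1) .
      then have "ones (g (f w)) = B - S \<union> (S \<inter> ones w)"
        by (subst onesg) (auto simp: f_def onesf[unfolded f_def])
      also have "\<dots> = ones w" using w assms by (auto simp: cube_face_def)
      finally show "g (f w) = w"
        using w by (intro ones_inject) (auto simp: g_def cube_face_def)
    qed
    show "\<forall>z\<in>{w. length w = card S}. f (g z) = z"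
    proof
      fix z :: "bool list" assume "z \<in> {w. length w = card S}"
      then have z: "length z = card S" by simp
      have "{..<card S} \<inter> e -` (B - S \<union> e ` ones z) = ones z"
        using eS ones_subset[OF z] by (auto dest: inj_onD)
      then have "ones (f (g z)) = ones z" by (simp add: onesf onesg z)
      then show "f (g z) = z" using z by (intro ones_inject) (simp_all add: f_def)
    qed
    show "f ` cube_face n B S \<subseteq> {w. length w = card S}" by (auto simp: f_def)
    show "g ` {w. length w = card S} \<subseteq> cube_face n B S"
    proof
      fix w assume "w \<in> g ` {w. length w = card S}"
      then obtain z where z: "length z = card S" "w = g z" by auto
      have "e ` ones z \<subseteq> S" using ones_subset[OF z(1)] eS by blast
      then show "w \<in> cube_face n B S"
        using onesg[OF z(1)] z assms by (auto simp: cube_face_def g_def)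
    qed
  qed
  have "card (sym_diff (ones (f x)) (ones (f y))) = card (sym_diff (ones x) (ones y))"
    if xy: "x \<in> cube_face n B S" "y \<in> cube_face n B S" for x y
  proof -
    have "sym_diff (ones x) (ones y) \<subseteq> S" using xy by (auto simp: cube_face_def)
    moreover have "e ` sym_diff (ones (f x)) (ones (f y)) =
        e ` {..<card S} \<inter> sym_diff (ones x) (ones y)"
      unfolding onesf by auto
    ultimately have "e ` sym_diff (ones (f x)) (ones (f y)) = sym_diff (ones x) (ones y)"
      unfolding eS(1) by (simp add: Int_absorb1)
    moreover have "inj_on e (sym_diff (ones (f x)) (ones (f y)))"
      using eS(2) by (rule inj_on_subset) (auto simp: onesf)
    ultimately show ?thesis by (metis card_image)
  qed
  then show ?thesis
    using bij by (subst digraph_iso_induced_hypercube_iff) (auto simp: cube_face_def)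
qed

text \<open>Converse of \<open>digraph_iso_cube_face\<close>. The inverse isomorphism, read on sets,
  is a cube embedding, so its image is the set of all translates of one set by the subsets of a
  \<open>k\<close>-set, and these fill an interval.\<close>

lemma digraph_iso_hypercube_imp_cube_face:
  assumes V: "V \<subseteq> {w. length w = n}"
    and iso: "digraph_iso (hypercube n \<restriction> V) (hypercube k)"
  obtains B S where "B \<subseteq> {..<n}" "S \<subseteq> B" "card S = k" "V = cube_face n B S"
proof -
  obtain f where f: "bij_betw f V {w. length w = k}"
    and adj: "\<And>x y. x \<in> V \<Longrightarrow> y \<in> V \<Longrightarrow> card (sym_diff (ones x) (ones y)) = 1 \<longleftrightarrow>
        card (sym_diff (ones (f x)) (ones (f y))) = 1"
    using iso unfolding digraph_iso_induced_hypercube_iff[OF V] by blast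
  define g where "g = inv_into V f"
  have g: "bij_betw g {w. length w = k} V" unfolding g_def using f by (rule bij_betw_inv_into)
  have fg: "f (g z) = z" if "length z = k" for z
    unfolding g_def using f that by (simp add: bij_betw_inv_into_right)
  have gV: "g z \<in> V" if "length z = k" for z using g that by (auto simp: bij_betw_def)
  define \<phi> where "\<phi> A = ones (g (word k A))" for A
  have \<phi>_sub: "\<phi> A \<subseteq> {..<n}" for A
    unfolding \<phi>_def using V gV[of "word k A"] by (intro ones_subset) auto
  have inj: "inj_on \<phi> (Pow {..<k})"
  proof (rule inj_onI)
    fix A B assume AB: "A \<in> Pow {..<k}" "B \<in> Pow {..<k}" "\<phi> A = \<phi> B"
    have "length (g (word k A)) = n" "length (g (word k B)) = n"
      using V gV[OF length_word[of k A]] gV[OF length_word[of k B]] by auto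
    then have "g (word k A) = g (word k B)"
      using AB(3) by (intro ones_inject) (simp_all add: \<phi>_def)
    then have "word k A = word k B" by (metis fg length_word)
    then have "ones (word k A) = ones (word k B)" by simp
    then show "A = B" using AB by auto
  qed
  have "card (sym_diff (\<phi> A) (\<phi> B)) = 1"
    if AB: "A \<subseteq> {..<k}" "B \<subseteq> {..<k}" "card (sym_diff A B) = 1" for A B
  proof -
    have "ones (word k A) = A" "ones (word k B) = B" using AB by auto
    then show ?thesis
      unfolding \<phi>_def using AB(3) by (subst adj) (auto simp: gV fg)
  qed
  then obtain e where e: "inj_on e {..<k}"
    and \<phi>: "\<And>A. A \<subseteq> {..<k} \<Longrightarrow> \<phi> A = sym_diff (\<phi> {}) (e ` A)"
    using cube_embedding_translation[OF finite_lessThan inj] by blast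
  define S where "S = e ` {..<k}"
  \<comment> \<open>\<open>\<phi> {}\<close> can be any corner of the face. Its translates by
    subsets of \<open>S\<close> range from \<open>\<phi> {} - S\<close>, which is
    \<open>B - S\<close>, up to \<open>\<phi> {} \<union> S\<close>.\<close>
  define B where "B = \<phi> {} \<union> S"
  \<comment> \<open>Each element of \<open>S\<close> lies in \<open>\<phi> {}\<close> or in the
    image of the full set \<open>{..<k}\<close>, both bounded by \<open>n\<close>.\<close>
  have "sym_diff (\<phi> {}) S \<subseteq> {..<n}" using \<phi>_sub[of "{..<k}"] \<phi>[of "{..<k}"] by (simp add: S_def)
  then have B_sub: "B \<subseteq> {..<n}" using \<phi>_sub[of "{}"] by (auto simp: B_def)
  have "V = cube_face n B S"
  proof (intro equalityI subsetI)
    fix w assume w: "w \<in> V"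
    then obtain z where z: "length z = k" "w = g z" using g by (auto simp: bij_betw_def)
    then have "ones w = \<phi> (ones z)" by (simp add: \<phi>_def)
    then have "ones w = sym_diff (\<phi> {}) (e ` ones z)"
      using \<phi>[OF ones_subset[OF z(1)]] by (rule trans)
    moreover have "e ` ones z \<subseteq> S" using ones_subset[OF z(1)] by (auto simp: S_def)
    ultimately show "w \<in> cube_face n B S" using w V by (auto simp: cube_face_def B_def)
  next
    fix w assume w: "w \<in> cube_face n B S"
    \<comment> \<open>The translation that takes \<open>\<phi> {}\<close> to \<open>ones w\<close>;
      its preimage under \<open>e\<close> names the cube vertex sent to \<open>w\<close>.\<close>
    define T where "T = sym_diff (\<phi> {}) (ones w)"
    have "T \<subseteq> S" using w by (auto simp: T_def cube_face_def B_def)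
    then obtain A where A: "A \<subseteq> {..<k}" "T = e ` A" unfolding S_def by (meson subset_imageE)
    have "\<phi> A = ones w" using \<phi>[OF A(1)] unfolding A(2)[symmetric] T_def by auto
    moreover have "length (g (word k A)) = n" using V gV[OF length_word[of k A]] by auto
    ultimately have "g (word k A) = w"
      using w by (intro ones_inject) (auto simp: \<phi>_def cube_face_def)
    then show "w \<in> V" using gV by auto
  qed
  moreover have "card S = k" using e by (simp add: S_def card_image)
  ultimately show thesis using that[of B S] B_sub by (auto simp: B_def)
qed

section \<open>Induced subgraphs on down-closed families\<close>

lemma (in wf_digraph) awalk_cost_one: "awalk_cost (\<lambda>_. 1) p = real (length p)"
  by (induction p) auto

text \<open>Abstract form of a daisy cube: the supports of its vertices form a down-closed family
  \<open>D\<close>, and no generating set is mentioned.\<close>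

locale down_family =
  fixes n :: nat and D :: "nat set set"
  assumes sub: "A \<in> D \<Longrightarrow> A \<subseteq> {..<n}"
    and down: "A \<in> D \<Longrightarrow> B \<subseteq> A \<Longrightarrow> B \<in> D"
begin

definition cube :: "(bool list, bool list \<times> bool list) pre_digraph" where
  "cube = hypercube n \<restriction> {w. length w = n \<and> ones w \<in> D}"

lemma verts_cube [simp]: "verts cube = {w. length w = n \<and> ones w \<in> D}"
  and tail_cube [simp]: "tail cube = fst"
  and head_cube [simp]: "head cube = snd"
  by (simp_all add: cube_def)

lemma arcs_cube: "(u, v) \<in> arcs cube \<longleftrightarrow>
    u \<in> verts cube \<and> v \<in> verts cube \<and> card (sym_diff (ones u) (ones v)) = 1"
  by (auto simp: cube_def)

sublocale wf_digraph cube
  unfolding cube_def using wf_digraph_hypercube by (rule wf_digraph.wellformed_induce_subgraph)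

lemma finite_D: "finite D"
  by (rule finite_subset[of _ "Pow {..<n}"]) (use sub in auto)

lemma finite_verts_cube: "finite (verts cube)"
  by (rule finite_subset[OF _ finite_lists_length_eq[of UNIV n]]) auto

text \<open>Lets the isomorphism results for subgraphs of the full hypercube apply inside
  \<open>cube\<close>.\<close>

lemma induce_cube:
  assumes "V \<subseteq> verts cube"
  shows "cube \<restriction> V = hypercube n \<restriction> V"
  using assms by (auto simp: cube_def induce_subgraph_def)

section \<open>Graph distance is Hamming distance\<close>

lemma hamming_le_awalk_length:
  "awalk u p v \<Longrightarrow> card (sym_diff (ones u) (ones v)) \<le> length p"
proof (induction p arbitrary: u)
  case Nil
  then show ?case by (simp add: awalk_simps)
next
  case (Cons a p)
  obtain x y where a: "a = (x, y)" by fastforce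
  have *: "(x, y) \<in> arcs cube" "u = x" "awalk y p v" using Cons.prems by (simp_all add: awalk_simps a)
  then have "card (sym_diff (ones u) (ones v)) \<le> 1 + card (sym_diff (ones y) (ones v))"
    using card_sym_diff_triangle[of "ones u" "ones y" "ones v"] arcs_cube[of x y] by simp
  then show ?case using Cons.IH[OF *(3)] by simp
qed

text \<open>A shortest walk in the hypercube stays inside \<open>D\<close> if it first deletes the
  elements missing from \<open>v\<close>, remaining below \<open>u\<close>, and then adds the
  missing ones, remaining below \<open>v\<close>.\<close>

lemma hamming_awalk:
  assumes "u \<in> verts cube" "v \<in> verts cube"
  shows "\<exists>p. awalk u p v \<and> length p = card (sym_diff (ones u) (ones v))"
  using assms(1)
proof (induction "card (sym_diff (ones u) (ones v))" arbitrary: u)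
  case 0
  then have "ones u = ones v" by auto
  then have "u = v" using 0 assms(2) by (intro ones_inject) auto
  then show ?case using assms(2) by (intro exI[of _ "[]"]) (simp add: awalk_simps)
next
  case (Suc d)
  \<comment> \<open>\<open>A\<close> is the support of the next vertex, one toggle closer to
    \<open>v\<close>; an element is added only once nothing is left to delete.\<close>
  obtain A i where A: "A \<in> D" "sym_diff (ones u) A = {i}"
    "sym_diff (ones u) (ones v) = insert i (sym_diff A (ones v))" "i \<notin> sym_diff A (ones v)"
  proof (cases "ones u \<subseteq> ones v")
    case True
    then obtain i where "i \<in> ones v" "i \<notin> ones u"
      using Suc.hyps(2) card.empty[where 'a = nat]
      by (metis Diff_eq_empty_iff Un_empty_left nat.distinct(1) subsetI)
    moreover have "insert i (ones u) \<in> D"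
      using down[of "ones v" "insert i (ones u)"] assms(2) True \<open>i \<in> ones v\<close> by auto
    ultimately show thesis by (intro that[of "insert i (ones u)" i]) auto
  next
    case False
    then obtain i where "i \<in> ones u" "i \<notin> ones v" by auto
    moreover have "ones u - {i} \<in> D" using down[of "ones u" "ones u - {i}"] Suc.prems by auto
    ultimately show thesis by (intro that[of "ones u - {i}" i]) auto
  qed
  define w where "w = word n A"
  have w: "w \<in> verts cube" "ones w = A" using A(1) sub[OF A(1)] by (auto simp: w_def Int_absorb2)
  have "finite A" using sub[OF A(1)] by (meson finite_lessThan finite_subset)
  then have "d = card (sym_diff (ones w) (ones v))" using Suc.hyps(2) A(3,4) w(2) by simp
  then obtain p where p: "awalk w p v" "length p = d" using Suc.hyps(1) w(1) by metis
  have "(u, w) \<in> arcs cube" using Suc.prems w A(2) by (simp add: arcs_cube)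
  then have "awalk u ((u, w) # p) v" using p by (simp add: awalk_simps)
  then show ?case using p Suc.hyps(2) by (metis length_Cons)
qed

lemma graph_dist_cube:
  assumes "u \<in> verts cube" "v \<in> verts cube"
  shows "graph_dist cube u v = ereal (real (card (sym_diff (ones u) (ones v))))"
  unfolding graph_dist_def \<mu>_def
proof (rule INF_eqI)
  fix p assume "p \<in> {p. awalk u p v}"
  then show "ereal (real (card (sym_diff (ones u) (ones v)))) \<le> ereal (awalk_cost (\<lambda>_. 1) p)"
    using hamming_le_awalk_length by (simp add: awalk_cost_one)
next
  fix y :: ereal
  assume y: "\<And>p. p \<in> {p. awalk u p v} \<Longrightarrow> y \<le> ereal (awalk_cost (\<lambda>_. 1) p)"
  obtain p where "awalk u p v" "length p = card (sym_diff (ones u) (ones v))"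
    using hamming_awalk[OF assms] by blast
  then show "y \<le> ereal (real (card (sym_diff (ones u) (ones v))))"
    using y[of p] by (simp add: awalk_cost_one)
qed

section \<open>Counting cubes by top, dimension and distance\<close>

lemma cube_face_subset_iff:
  assumes "B \<subseteq> {..<n}" "S \<subseteq> B"
  shows "cube_face n B S \<subseteq> verts cube \<longleftrightarrow> B \<in> D"
proof
  assume *: "cube_face n B S \<subseteq> verts cube"
  have "word n B \<in> cube_face n B S" using assms by (auto simp: cube_face_def)
  then have "ones (word n B) \<in> D" using * by auto
  then show "B \<in> D" using assms by (simp add: Int_absorb2)
qed (auto simp: cube_face_def intro: down)

text \<open>Off \<open>S\<close> every word of the face agrees with \<open>B\<close>, so the
  disagreements of \<open>u\<close> with \<open>B\<close> there cannot be avoided. On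
  \<open>S\<close> the word is free to copy \<open>u\<close>.\<close>

lemma subgraph_dist_cube_face:
  assumes "u \<in> verts cube" "B \<in> D" "S \<subseteq> B"
  shows "subgraph_dist cube u (cube \<restriction> cube_face n B S) =
    ereal (real (card (sym_diff (ones u) B - S)))"
proof -
  have B: "B \<subseteq> {..<n}" using sub assms(2) .
  have face: "cube_face n B S \<subseteq> verts cube" using cube_face_subset_iff[OF B assms(3)] assms(2) by simp
  have fin: "finite B" using B by (meson finite_lessThan finite_subset)
  show ?thesis
    unfolding subgraph_dist_def induce_subgraph_verts
  proof (rule Min_eqI)
    show "finite (graph_dist cube u ` cube_face n B S)"
      using finite_subset[OF face finite_verts_cube] by simp
    fix y assume "y \<in> graph_dist cube u ` cube_face n B S"
    then obtain w where w: "w \<in> cube_face n B S" "y = graph_dist cube u w" by blast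
    have "card (sym_diff (ones u) B - S) \<le> card (sym_diff (ones u) (ones w))"
      using w(1) by (intro card_mono) (auto simp: cube_face_def)
    then show "ereal (real (card (sym_diff (ones u) B - S))) \<le> y"
      using w face assms(1) by (auto simp: graph_dist_cube subset_iff)
  next
    \<comment> \<open>The vertex of the face nearest to \<open>u\<close>: equal to \<open>B\<close>
      off \<open>S\<close> and to \<open>u\<close> on \<open>S\<close>.\<close>
    define w where "w = word n (B - S \<union> (ones u \<inter> S))"
    have w: "ones w = B - S \<union> (ones u \<inter> S)" using B assms(3) by (auto simp: w_def)
    have "w \<in> cube_face n B S" using assms(3) w by (auto simp: cube_face_def w_def)
    moreover have "sym_diff (ones u) (ones w) = sym_diff (ones u) B - S"
      using w assms(3) by auto
    ultimately show "ereal (real (card (sym_diff (ones u) B - S))) \<in>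
        graph_dist cube u ` cube_face n B S"
      using face graph_dist_cube[OF assms(1), of w] by (auto intro!: image_eqI[of _ _ w])
  qed
qed

text \<open>Induced subgraphs are determined by their vertex sets, and those isomorphic to a cube
  are the faces with top in \<open>D\<close>. Pairs \<open>(B, S)\<close> therefore enumerate them
  without repetition.\<close>

lemma cube_count_eq:
  assumes u: "u \<in> verts cube"
  shows "cube_count cube u k d =
    card {(B, S) \<in> (SIGMA B:D. Pow B). card S = k \<and> card (sym_diff (ones u) B - S) = d}"
    (is "_ = card ?I")
proof -
  define h where "h = (\<lambda>(B, S). cube \<restriction> cube_face n B S)"
  have "{H. induced_subgraph H cube \<and> digraph_iso H (hypercube k) \<and>
      subgraph_dist cube u H = ereal (real d)} = h ` ?I" (is "?C = _")
  proof (intro equalityI subsetI)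
    fix H assume "H \<in> ?C"
    then have H: "induced_subgraph H cube" "digraph_iso H (hypercube k)"
      "subgraph_dist cube u H = ereal (real d)" by auto
    have V: "verts H \<subseteq> verts cube" and H_eq: "H = cube \<restriction> verts H"
      using H(1) by (auto simp: induced_subgraph_def subgraph_def compatible_def induce_subgraph_def)
    have iso: "digraph_iso (hypercube n \<restriction> verts H) (hypercube k)"
      using H(2) H_eq induce_cube[OF V] by metis
    have "verts H \<subseteq> {w. length w = n}" using V by auto
    from digraph_iso_hypercube_imp_cube_face[OF this iso] obtain B S
      where BS: "B \<subseteq> {..<n}" "S \<subseteq> B" "card S = k" "verts H = cube_face n B S" by blast
    then have "B \<in> D" using V cube_face_subset_iff by simp
    moreover have "H = h (B, S)" using H_eq BS(4) by (simp add: h_def)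
    ultimately show "H \<in> h ` ?I"
      using subgraph_dist_cube_face[OF u] BS H(3) by (auto simp: h_def)
  next
    fix H assume "H \<in> h ` ?I"
    then obtain B S where BS: "B \<in> D" "S \<subseteq> B" "card S = k" "card (sym_diff (ones u) B - S) = d"
      "H = cube \<restriction> cube_face n B S" by (auto simp: h_def)
    have B: "B \<subseteq> {..<n}" using sub BS(1) .
    have face: "cube_face n B S \<subseteq> verts cube" using cube_face_subset_iff[OF B BS(2)] BS(1) by simp
    then have "induced_subgraph H cube" unfolding BS(5) by (rule induced_induce)
    moreover have "digraph_iso H (hypercube k)"
      using digraph_iso_cube_face[OF B BS(2)] by (simp add: BS(3,5) induce_cube[OF face])
    ultimately show "H \<in> ?C" using subgraph_dist_cube_face[OF u] BS by simp
  qed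
  moreover have "inj_on h ?I"
  proof (rule inj_onI)
    fix p q assume "p \<in> ?I" "q \<in> ?I" and eq: "h p = h q"
    then obtain B S B' S' where pq: "p = (B, S)" "q = (B', S')" "B \<in> D" "B' \<in> D" "S \<subseteq> B" "S' \<subseteq> B'"
      by auto
    have "cube_face n B S = cube_face n B' S'"
      using arg_cong[OF eq, of verts] by (simp add: h_def pq)
    then show "p = q"
      using cube_face_inject[of B n B' S S'] sub pq by simp
  qed
  ultimately show ?thesis unfolding cube_count_def by (simp add: card_image)
qed

text \<open>The coefficients count the pairs \<open>(B, S)\<close> by exponents, so undoing this
  grouping turns the value into the signed sum over all pairs. Evaluating the outer variable
  \<open>y\<close> at \<open>- [:0, 1:]\<close> is the substitution of \<open>-x\<close>, with the
  result still a polynomial in \<open>x\<close>.\<close>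

lemma distance_cube_poly_eq_1:
  assumes u: "u \<in> verts cube"
  shows "poly (distance_cube_poly cube u) (- [:0, 1:]) = 1"
proof -
  let ?X = "[:0, 1:] :: int poly"
  define I where "I = (SIGMA B:D. Pow B)"
  define key where "key = (\<lambda>(B, S). (card S, card (sym_diff (ones u) B - S)))"
  define N where "N = {(k, d). cube_count cube u k d \<noteq> 0}"
  have finI: "finite I"
    unfolding I_def using finite_D sub by (intro finite_SigmaI) (auto intro: finite_subset)
  have count: "cube_count cube u k d = card {p \<in> I. key p = (k, d)}" for k d
    unfolding cube_count_eq[OF u] by (rule arg_cong[of _ _ card]) (auto simp: I_def key_def)
  have finN: "finite N" unfolding N_def using finite_cube_count_support[OF finite_verts_cube] .
  \<comment> \<open>Every pair falls into a class that the polynomial sums over, so none is lost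
    when the classes are merged.\<close>
  have key_N: "key ` I \<subseteq> N"
  proof
    fix q assume "q \<in> key ` I"
    then obtain p where "p \<in> I" "key p = (fst q, snd q)" by auto
    then have "{p \<in> I. key p = (fst q, snd q)} \<noteq> {}" by blast
    then have "cube_count cube u (fst q) (snd q) \<noteq> 0" unfolding count using finI by simp
    then show "q \<in> N" by (simp add: N_def case_prod_beta)
  qed
  have "poly (distance_cube_poly cube u) (- ?X) =
      (\<Sum>q\<in>N. of_nat (cube_count cube u (fst q) (snd q)) * (?X ^ fst q * (- ?X) ^ snd q))"
    unfolding distance_cube_poly_def N_def[symmetric] poly_sum
    by (intro sum.cong) (auto simp: poly_monom monom_altdef of_nat_poly mult.assoc)
  also have "\<dots> = (\<Sum>q\<in>N. \<Sum>p\<in>{p \<in> I. key p = q}. ?X ^ fst (key p) * (- ?X) ^ snd (key p))"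
    unfolding count by (intro sum.cong) auto
  also have "\<dots> = (\<Sum>p\<in>I. ?X ^ fst (key p) * (- ?X) ^ snd (key p))"
    using finI finN key_N by (rule sum.group)
  also have "\<dots> = (\<Sum>(B, S)\<in>I. ?X ^ card S * (- ?X) ^ card (sym_diff (ones u) B - S))"
    by (simp add: key_def case_prod_beta)
  also have "\<dots> = 1"
    unfolding I_def
  proof (rule down_set_signed_sum)
    show "finite A" if "A \<in> D" for A using sub[OF that] by (meson finite_lessThan finite_subset)
    show "ones u \<in> D" using u by simp
  qed (use finite_D down in auto)
  finally show ?thesis .
qed

end

theorem theorem4p1:
  fixes n :: nat and X :: "bool list set" and u :: "bool list"
  assumes "X \<subseteq> {w. length w = n}"
    and "u \<in> verts (daisy_cube n X)"
  shows "poly (distance_cube_poly (daisy_cube n X) u) (- [:0, 1:]) = 1"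
proof -
  \<comment> \<open>The supports of the vertices: the down-closure of the supports of the
    generators.\<close>
  define D where "D = {A. \<exists>x\<in>X. A \<subseteq> ones x}"
  interpret down_family n D
  proof
    show "A \<subseteq> {..<n}" if "A \<in> D" for A
      using that assms(1) ones_subset unfolding D_def by blast
  qed (auto simp: D_def)
  have "{u \<in> verts (hypercube n). \<exists>x\<in>X. list_all2 (\<le>) u x} = {w. length w = n \<and> ones w \<in> D}"
  proof (rule Collect_cong)
    have "length x = n" if "x \<in> X" for x using that assms(1) by auto
    then show "u \<in> verts (hypercube n) \<and> (\<exists>x\<in>X. list_all2 (\<le>) u x) \<longleftrightarrow>
        length u = n \<and> ones u \<in> D" for u
      by (auto simp: D_def list_all2_le_iff_ones)
  qed
  then have "daisy_cube n X = cube" by (simp add: daisy_cube_def cube_def)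
  then show ?thesis using distance_cube_poly_eq_1 assms(2) by simp
qed

end
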